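(* Fix $\sigma>0$. For $k>0$ let $s^\star=s^\star(k)>0$ be a global minimizer over $s\in(0,\infty)$ of $$J(s)=k^2(\sigma-s)^2+\frac{s^2}{1+s^2}.$$ As $k^2\to\infty$, $s^\star=\sigma+O(k^{-2})$, so the optimal Gaussian $\mathcal N(0,(s^\star)^2)$ approaches $P=\mathcal N(0,\sigma^2)$. As $k^2\to0$, $s^\star=k^2\sigma+O(k^4)\to0$ and $J(s^\star)=k^2\sigma^2+O(k^4)\to0$, so the minimizer $\mathcal N(0,(s^\star)^2)$ collapses toward the point mass $\delta_0$.
   Context: $J(s)$ is the value of $k^2W_2^2(P,Q)+\operatorname{mmse}(Q)$ for $P=\mathcal N(0,\sigma^2)$ and $Q=\mathcal N(0,s^2)$, where $\operatorname{mmse}(Q)=\mathbb E[\operatorname{Var}(Y\mid Y+N)]$ with $Y\sim Q$, $N\sim\mathcal N(0,1)$ independent. Constants in $O(\cdot)$ may depend on $\sigma$. *)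

theory Defs
  imports "HOL-Probability.Probability" "HOL-Library.Landau_Symbols"
begin

definition J :: "real \<Rightarrow> real \<Rightarrow> real \<Rightarrow> real" where
  "J \<sigma> k s = k\<^sup>2 * (\<sigma> - s)\<^sup>2 + s\<^sup>2 / (1 + s\<^sup>2)"

text \<open>The second argument of \<^const>\<open>normal_density\<close> is the standard deviation, so for \<open>s > 0\<close>
  this is the law with mean \<open>0\<close> and variance \<open>s\<^sup>2\<close>. The degenerate case \<open>s = 0\<close> is not covered; the
  point mass at \<open>0\<close> is \<open>return borel 0\<close>.\<close>

definition centered_gaussian :: "real \<Rightarrow> real measure" where
  "centered_gaussian s = density lborel (\<lambda>x. ennreal (normal_density 0 s x))"

definition couplings :: "real measure \<Rightarrow> real measure \<Rightarrow> (real \<times> real) measure set" where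
  "couplings P Q = {\<pi>. sets \<pi> = sets (borel \<Otimes>\<^sub>M borel) \<and> distr \<pi> borel fst = P \<and> distr \<pi> borel snd = Q}"

text \<open>The squared 2-Wasserstein distance. It takes values in \<^typ>\<open>ennreal\<close>, so infinite cost is
  not conflated with cost \<open>0\<close>.\<close>

definition W2_squared :: "real measure \<Rightarrow> real measure \<Rightarrow> ennreal" where
  "W2_squared P Q = (INF \<pi>\<in>couplings P Q. \<integral>\<^sup>+z. ennreal ((fst z - snd z)\<^sup>2) \<partial>\<pi>)"

text \<open>The library's weak convergence \<^const>\<open>weak_conv_m\<close> is for sequences; along a filter on the
  reals it is required for every sequence of parameters that tends to the filter. For the countably
  generated filters \<^term>\<open>at_top :: real filter\<close> and \<^term>\<open>at_right (0 :: real)\<close> this is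
  convergence along the filter.\<close>

definition weak_conv_along :: "(real \<Rightarrow> real measure) \<Rightarrow> real measure \<Rightarrow> real filter \<Rightarrow> bool" where
  "weak_conv_along Q P F \<longleftrightarrow>
     (\<forall>\<kappa> :: nat \<Rightarrow> real. filterlim \<kappa> F sequentially \<longrightarrow> weak_conv_m (\<lambda>n. Q (\<kappa> n)) P)"

end

theory Submission
  imports Defs
begin

text \<open>A minimizer \<open>s\<close> of \<^term>\<open>J \<sigma> k\<close> lies in the open set \<open>s > 0\<close>, hence is critical:
  \<open>k\<^sup>2 (\<sigma> - s) = s / (1 + s\<^sup>2)\<^sup>2\<close>. This forces \<open>s < \<sigma>\<close>, then \<open>\<sigma> - s \<le> \<sigma> / k\<^sup>2\<close> and
  \<open>s \<le> k\<^sup>2 \<sigma> (1 + \<sigma>\<^sup>2)\<^sup>2\<close>; feeding the last bound back into the critical equation and into \<^const>\<open>J\<close>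
  gives both expansions at \<open>k = 0\<close>. For the laws, all centered Gaussians, \<open>\<delta>\<^sub>0\<close> included, are images
  of one standard Gaussian \<open>Z\<close> under \<open>z \<mapsto> s z\<close>: dominated convergence gives weak convergence,
  and the coupling \<open>(s Z, t Z)\<close> gives \<open>W\<^sub>2\<^sup>2 \<le> (s - t)\<^sup>2\<close>.\<close>

section \<open>First-order condition for minimizers\<close>

lemma J_has_derivative:
  "(J \<sigma> k has_real_derivative (2 * s / (1 + s\<^sup>2)\<^sup>2 - 2 * k\<^sup>2 * (\<sigma> - s))) (at s)"
proof -
  have pos: "1 + s\<^sup>2 \<noteq> 0"
    by (metis add_pos_nonneg less_irrefl zero_le_power2 zero_less_one)
  have "((\<lambda>s. k\<^sup>2 * (\<sigma> - s)\<^sup>2 + s\<^sup>2 / (1 + s\<^sup>2)) has_real_derivative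
      (2 * s / (1 + s\<^sup>2)\<^sup>2 - 2 * k\<^sup>2 * (\<sigma> - s))) (at s)"
    using pos by (auto intro!: derivative_eq_intros simp: field_simps power2_eq_square)
  then show ?thesis
    by (simp add: J_def[abs_def])
qed

lemma arg_min_J_critical:
  assumes "is_arg_min (J \<sigma> k) (\<lambda>s. s > 0) s"
  shows "s = k\<^sup>2 * (\<sigma> - s) * (1 + s\<^sup>2)\<^sup>2"
proof -
  have s: "s > 0" and min: "\<And>y. y > 0 \<Longrightarrow> J \<sigma> k s \<le> J \<sigma> k y"
    using assms by (auto simp: is_arg_min_linorder)
  \<comment> \<open>The radius \<open>s\<close> keeps every competitor \<open>y\<close> positive, so
    the constrained minimum is an unconstrained local one.\<close>
  have "\<forall>y. \<bar>s - y\<bar> < s \<longrightarrow> J \<sigma> k s \<le> J \<sigma> k y"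
    by (auto intro!: min)
  from DERIV_local_min[OF J_has_derivative s this]
  have "s / (1 + s\<^sup>2)\<^sup>2 = k\<^sup>2 * (\<sigma> - s)" by simp
  moreover have "(1 + s\<^sup>2)\<^sup>2 > 0"
    by (intro zero_less_power add_pos_nonneg) simp_all
  ultimately show ?thesis by (simp add: divide_eq_eq)
qed

section \<open>Explicit bounds at a positive critical point\<close>

context
  fixes \<sigma> k s :: real
  assumes s: "s > 0" and k: "k > 0"
    and critical: "s = k\<^sup>2 * (\<sigma> - s) * (1 + s\<^sup>2)\<^sup>2"
begin

lemma critical_less: "s < \<sigma>"
proof (rule ccontr)
  assume "\<not> s < \<sigma>"
  then have "k\<^sup>2 * (\<sigma> - s) * (1 + s\<^sup>2)\<^sup>2 \<le> 0"
    by (simp add: mult_nonneg_nonpos mult_nonpos_nonneg)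
  with critical s show False by simp
qed

text \<open>Replacing \<open>(1 + s^2)^2\<close> by its lower bound 1 in the critical equation gives
  \<open>k^2 * (\<sigma> - s) \<le> s\<close>, and \<open>s < \<sigma>\<close>.\<close>

lemma critical_far: "\<bar>s - \<sigma>\<bar> \<le> \<sigma> / k\<^sup>2"
proof -
  have "k\<^sup>2 * (\<sigma> - s) * 1 \<le> k\<^sup>2 * (\<sigma> - s) * (1 + s\<^sup>2)\<^sup>2"
    using critical_less by (intro mult_left_mono) (auto simp: one_le_power)
  also have "\<dots> = s" using critical by simp
  also have "\<dots> \<le> \<sigma>" using critical_less by simp
  finally have "\<sigma> - s \<le> \<sigma> / k\<^sup>2"
    using k by (simp add: pos_le_divide_eq mult.commute)
  then show ?thesis using critical_less by simp
qed

text \<open>On the right of the critical equation, \<open>\<sigma> - s\<close> is at most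
  \<open>\<sigma>\<close>, and \<open>s\<close> in the last factor is at most
  \<open>\<sigma>\<close>.\<close>

lemma critical_le: "s \<le> \<sigma> * (1 + \<sigma>\<^sup>2)\<^sup>2 * k\<^sup>2"
proof -
  have "(1 + s\<^sup>2)\<^sup>2 \<le> (1 + \<sigma>\<^sup>2)\<^sup>2"
    using s critical_less by (intro power_mono add_left_mono) auto
  then have "k\<^sup>2 * (\<sigma> - s) * (1 + s\<^sup>2)\<^sup>2 \<le> k\<^sup>2 * \<sigma> * (1 + \<sigma>\<^sup>2)\<^sup>2"
    using s critical_less by (intro mult_mono) auto
  then have "s \<le> k\<^sup>2 * \<sigma> * (1 + \<sigma>\<^sup>2)\<^sup>2"
    by (rule ord_eq_le_trans[OF critical])
  then show ?thesis by (simp only: mult_ac)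
qed

lemma critical_expansion: "\<bar>s - k\<^sup>2 * \<sigma>\<bar> \<le> \<sigma> * (1 + \<sigma>\<^sup>2) ^ 4 * k ^ 4"
proof -
  \<comment> \<open>Chosen so that
    \<open>(\<sigma> - s) * (1 + s^2)^2 - \<sigma> = s * (r - 1)\<close>: the error is
    \<open>k^2 * s\<close> times a bounded factor, and \<open>critical_le\<close> supplies the
    second \<open>k^2\<close>.\<close>
  define r where "r = (\<sigma> - s) * (2 * s + s ^ 3)"
  have "s - k\<^sup>2 * \<sigma> = k\<^sup>2 * (\<sigma> - s) * (1 + s\<^sup>2)\<^sup>2 - k\<^sup>2 * \<sigma>"
    using critical by simp
  also have "\<dots> = k\<^sup>2 * s * (r - 1)"
    by (simp add: r_def power2_eq_square power3_eq_cube algebra_simps)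
  finally have eq: "s - k\<^sup>2 * \<sigma> = k\<^sup>2 * s * (r - 1)" .
  have "0 \<le> r"
    using s critical_less by (simp add: r_def)
  moreover have "r \<le> \<sigma> * (2 * \<sigma> + \<sigma> ^ 3)"
    unfolding r_def using s critical_less
    by (intro mult_mono add_mono power_mono) auto
  ultimately have "\<bar>r - 1\<bar> \<le> 1 + \<sigma> * (2 * \<sigma> + \<sigma> ^ 3)" by linarith
  also have "\<dots> = (1 + \<sigma>\<^sup>2)\<^sup>2"
    by (simp add: power2_eq_square power3_eq_cube algebra_simps)
  finally have "\<bar>r - 1\<bar> \<le> (1 + \<sigma>\<^sup>2)\<^sup>2" .
  then have "\<bar>s - k\<^sup>2 * \<sigma>\<bar> \<le> k\<^sup>2 * (\<sigma> * (1 + \<sigma>\<^sup>2)\<^sup>2 * k\<^sup>2) * (1 + \<sigma>\<^sup>2)\<^sup>2"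
    unfolding eq abs_mult using s critical_less critical_le
    by (intro mult_mono) auto
  also have "\<dots> = \<sigma> * ((1 + \<sigma>\<^sup>2)\<^sup>2 * (1 + \<sigma>\<^sup>2)\<^sup>2) * (k\<^sup>2 * k\<^sup>2)"
    by (simp only: mult_ac)
  also have "\<dots> = \<sigma> * (1 + \<sigma>\<^sup>2) ^ 4 * k ^ 4"
    by (simp only: power_add[symmetric]) simp
  finally show ?thesis .
qed

text \<open>The difference consists of the term \<open>s^2 / (1 + s^2)\<close> minus
  \<open>k^2 * s * (2 * \<sigma> - s)\<close>. Both are nonnegative and of order \<open>k^4\<close>
  because \<open>s \<le> A * k^2\<close>.\<close>

lemma critical_value:
  defines "A \<equiv> \<sigma> * (1 + \<sigma>\<^sup>2)\<^sup>2"
  shows "\<bar>J \<sigma> k s - k\<^sup>2 * \<sigma>\<^sup>2\<bar> \<le> (2 * \<sigma> * A + A\<^sup>2) * k ^ 4"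
proof -
  have sA: "s \<le> A * k\<^sup>2" using critical_le by (simp add: A_def)
  have eq: "J \<sigma> k s - k\<^sup>2 * \<sigma>\<^sup>2 = s\<^sup>2 / (1 + s\<^sup>2) - k\<^sup>2 * (s * (2 * \<sigma> - s))"
    by (simp add: J_def power2_eq_square algebra_simps)
  have "0 \<le> s * (2 * \<sigma> - s)" "s * (2 * \<sigma> - s) \<le> A * k\<^sup>2 * (2 * \<sigma>)"
    using s critical_less sA by (auto intro!: mult_mono)
  then have "0 \<le> k\<^sup>2 * (s * (2 * \<sigma> - s))" "k\<^sup>2 * (s * (2 * \<sigma> - s)) \<le> k\<^sup>2 * (A * k\<^sup>2 * (2 * \<sigma>))"
    by (auto intro!: mult_left_mono)
  moreover have "0 \<le> s\<^sup>2 / (1 + s\<^sup>2)" by simp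
  moreover have "s\<^sup>2 / (1 + s\<^sup>2) \<le> s\<^sup>2"
  proof -
    have "s\<^sup>2 / (1 + s\<^sup>2) \<le> s\<^sup>2 / 1"
      by (intro divide_left_mono) (auto simp: add_pos_nonneg)
    then show ?thesis by simp
  qed
  moreover have "s\<^sup>2 \<le> (A * k\<^sup>2)\<^sup>2" using s sA by (intro power_mono) auto
  ultimately have "\<bar>J \<sigma> k s - k\<^sup>2 * \<sigma>\<^sup>2\<bar> \<le> k\<^sup>2 * (A * k\<^sup>2 * (2 * \<sigma>)) + (A * k\<^sup>2)\<^sup>2"
    unfolding eq by linarith
  also have "\<dots> = (2 * \<sigma> * A + A\<^sup>2) * k ^ 4"
    by (simp add: power2_eq_square power4_eq_xxxx algebra_simps)
  finally show ?thesis .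
qed

end

section \<open>Scaled Gaussians and weak convergence\<close>

lemma centered_gaussian_eq_distr:
  assumes "s > 0"
  shows "centered_gaussian s = distr std_normal_distribution borel (\<lambda>z. s * z)"
proof -
  interpret real_distribution std_normal_distribution
    by (rule real_dist_normal_dist)
  have "distributed std_normal_distribution lborel (\<lambda>z. z) (\<lambda>x. ennreal (std_normal_density x))"
    unfolding distributed_def by (auto intro!: distr_id2)
  \<comment> \<open>The scale must be nonzero. At \<open>s = 0\<close> the density vanishes since
    \<open>1 / 0 = 0\<close>, giving the null measure, whereas the image law is the point
    mass.\<close>
  from normal_density_affine[OF this, of s 0] assms
  have "density lborel (normal_density 0 s) = distr std_normal_distribution lborel (\<lambda>z. s * z)"
    by (simp add: distributed_def)
  also have "\<dots> = distr std_normal_distribution borel (\<lambda>z. s * z)"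
    by (intro distr_cong) auto
  finally show ?thesis by (simp add: centered_gaussian_def)
qed

lemma (in prob_space) distr_const_zero: "distr M borel (\<lambda>z. 0 :: real) = return borel 0"
  by (rule distr_const) simp

text \<open>Test functions bounded by 1 are dominated by the constant 1, integrable for a
  probability measure. No sign is imposed on \<open>b\<close>, so the collapse \<open>b = 0\<close>
  is included.\<close>

lemma (in real_distribution) weak_conv_m_scale:
  assumes "a \<longlonglongrightarrow> b"
  shows "weak_conv_m (\<lambda>n. distr M borel (\<lambda>z. a n * z)) (distr M borel (\<lambda>z. b * z))"
proof (rule integral_bdd_continuous_conv_imp_weak_conv)
  fix f :: "real \<Rightarrow> real"
  assume cont: "\<And>x. isCont f x" and bdd: "\<And>x. \<bar>f x\<bar> \<le> 1"
  have [measurable]: "f \<in> borel_measurable borel"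
    using cont by (intro borel_measurable_continuous_onI) (simp add: continuous_at_imp_continuous_on)
  have "(\<lambda>n. \<integral>z. f (a n * z) \<partial>M) \<longlonglongrightarrow> (\<integral>z. f (b * z) \<partial>M)"
  proof (rule integral_dominated_convergence[where w="\<lambda>_. 1"])
    have "(\<lambda>n. f (a n * z)) \<longlonglongrightarrow> f (b * z)" for z
      by (intro isCont_tendsto_compose[OF cont] tendsto_mult_right assms)
    then show "AE z in M. (\<lambda>n. f (a n * z)) \<longlonglongrightarrow> f (b * z)" by simp
  qed (use bdd in auto)
  then show "(\<lambda>n. integral\<^sup>L (distr M borel (\<lambda>z. a n * z)) f)
      \<longlonglongrightarrow> integral\<^sup>L (distr M borel (\<lambda>z. b * z)) f"
    by (simp add: integral_distr)
qed auto

text \<open>Convergence of distribution functions ignores finitely many indices. This allows for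
  parameters that are positive only eventually.\<close>

lemma weak_conv_m_cong_eventually:
  assumes "eventually (\<lambda>n. M n = N n) sequentially" and "weak_conv_m N L"
  shows "weak_conv_m M L"
  unfolding weak_conv_m_def weak_conv_def
proof (intro allI impI)
  fix x assume "isCont (cdf L) x"
  with assms(2) have "(\<lambda>n. cdf (N n) x) \<longlonglongrightarrow> cdf L x"
    by (simp add: weak_conv_m_def weak_conv_def)
  moreover have "eventually (\<lambda>n. cdf (M n) x = cdf (N n) x) sequentially"
    using assms(1) by eventually_elim simp
  ultimately show "(\<lambda>n. cdf (M n) x) \<longlonglongrightarrow> cdf L x"
    by (simp add: tendsto_cong)
qed

text \<open>The limit is written as an image law so that \<open>t = 0\<close> yields the point
  mass.\<close>

lemma weak_conv_along_centered_gaussian: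
  assumes lim: "(s \<longlongrightarrow> t) F" and pos: "eventually (\<lambda>k. s k > 0) F"
  shows "weak_conv_along (\<lambda>k. centered_gaussian (s k))
    (distr std_normal_distribution borel (\<lambda>z. t * z)) F"
  unfolding weak_conv_along_def
proof (intro allI impI)
  fix \<kappa> :: "nat \<Rightarrow> real" assume \<kappa>: "filterlim \<kappa> F sequentially"
  interpret real_distribution std_normal_distribution
    by (rule real_dist_normal_dist)
  have "eventually (\<lambda>n. s (\<kappa> n) > 0) sequentially"
    using eventually_compose_filterlim[OF pos \<kappa>] .
  then have "eventually (\<lambda>n. centered_gaussian (s (\<kappa> n)) =
      distr std_normal_distribution borel (\<lambda>z. s (\<kappa> n) * z)) sequentially"
    by eventually_elim (rule centered_gaussian_eq_distr)
  moreover have "(\<lambda>n. s (\<kappa> n)) \<longlonglongrightarrow> t"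
    using filterlim_compose[OF lim \<kappa>] .
  ultimately show "weak_conv_m (\<lambda>n. centered_gaussian (s (\<kappa> n)))
      (distr std_normal_distribution borel (\<lambda>z. t * z))"
    by (rule weak_conv_m_cong_eventually[OF _ weak_conv_m_scale])
qed

section \<open>Wasserstein bounds\<close>

lemma W2_squared_distr_le:
  assumes [measurable]: "X \<in> borel_measurable M" "Y \<in> borel_measurable M"
  shows "W2_squared (distr M borel X) (distr M borel Y) \<le> (\<integral>\<^sup>+z. ennreal ((X z - Y z)\<^sup>2) \<partial>M)"
proof -
  \<comment> \<open>The joint law of \<open>X\<close> and \<open>Y\<close> is a coupling, so its
    cost bounds the infimum.\<close>
  let ?\<pi> = "distr M (borel \<Otimes>\<^sub>M borel) (\<lambda>z. (X z, Y z))"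
  have "?\<pi> \<in> couplings (distr M borel X) (distr M borel Y)"
    by (simp add: couplings_def distr_distr comp_def)
  then have "W2_squared (distr M borel X) (distr M borel Y)
      \<le> (\<integral>\<^sup>+z. ennreal ((fst z - snd z)\<^sup>2) \<partial>?\<pi>)"
    unfolding W2_squared_def by (rule INF_lower)
  also have "\<dots> = (\<integral>\<^sup>+z. ennreal ((X z - Y z)\<^sup>2) \<partial>M)"
    by (simp add: nn_integral_distr)
  finally show ?thesis .
qed

lemma W2_squared_scaled_gaussian_le:
  "W2_squared (distr std_normal_distribution borel (\<lambda>z. s * z))
    (distr std_normal_distribution borel (\<lambda>z. t * z)) \<le> ennreal ((s - t)\<^sup>2)"
proof -
  have "(\<integral>\<^sup>+z. ennreal (z\<^sup>2) \<partial>std_normal_distribution) =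
      ennreal (\<integral>z. z\<^sup>2 \<partial>std_normal_distribution)"
    \<comment> \<open>The index 1 stands for the moment of order 2 * 1; integrability lets the
      extended integral be read off from the real one.\<close>
    using std_normal_distribution_even_moments(2)[of 1]
    by (intro nn_integral_eq_integral) auto
  then have second_moment: "(\<integral>\<^sup>+z. ennreal (z\<^sup>2) \<partial>std_normal_distribution) = 1"
    using std_normal_distribution_even_moments(1)[of 1] by simp
  have "W2_squared (distr std_normal_distribution borel (\<lambda>z. s * z))
      (distr std_normal_distribution borel (\<lambda>z. t * z))
      \<le> (\<integral>\<^sup>+z. ennreal ((s * z - t * z)\<^sup>2) \<partial>std_normal_distribution)"
    by (rule W2_squared_distr_le) auto
  also have "\<dots> = (\<integral>\<^sup>+z. ennreal ((s - t)\<^sup>2) * ennreal (z\<^sup>2) \<partial>std_normal_distribution)"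
    by (simp add: ennreal_mult power_mult_distrib flip: left_diff_distrib)
  also have "\<dots> = ennreal ((s - t)\<^sup>2)"
    by (subst nn_integral_cmult) (auto simp: second_moment)
  finally show ?thesis .
qed

text \<open>Since \<open>g\<close> is o(1), so is \<open>f\<close>; this turns the quantitative
  rates into plain limits.\<close>

lemma bigo_tendsto_zero:
  fixes f g :: "real \<Rightarrow> real"
  assumes "f \<in> O[F](g)" and "(g \<longlongrightarrow> 0) F"
  shows "(f \<longlongrightarrow> 0) F"
proof -
  have "g \<in> o[F](\<lambda>_. 1)"
    using assms(2) by (intro smalloI_tendsto) auto
  with assms(1) have "f \<in> o[F](\<lambda>_. 1)"
    by (rule landau_o.big_small_trans)
  from smalloD_tendsto[OF this] show ?thesis by simp
qed

lemma tendsto_W2_squared_centered_gaussian: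
  assumes lim: "(s \<longlongrightarrow> t) F" and pos: "eventually (\<lambda>k. s k > 0) F"
  shows "((\<lambda>k. W2_squared (centered_gaussian (s k))
    (distr std_normal_distribution borel (\<lambda>z. t * z))) \<longlongrightarrow> 0) F"
proof (rule tendsto_sandwich[OF _ _ tendsto_const])
  have "((\<lambda>k. (s k - t)\<^sup>2) \<longlongrightarrow> (t - t)\<^sup>2) F"
    by (intro tendsto_intros lim)
  from tendsto_ennrealI[OF this] show "((\<lambda>k. ennreal ((s k - t)\<^sup>2)) \<longlongrightarrow> 0) F"
    by simp
  show "eventually (\<lambda>k. W2_squared (centered_gaussian (s k))
      (distr std_normal_distribution borel (\<lambda>z. t * z)) \<le> ennreal ((s k - t)\<^sup>2)) F"
    using pos
    by eventually_elim (simp add: centered_gaussian_eq_distr W2_squared_scaled_gaussian_le)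
qed simp

theorem corollary3p16:
  fixes \<sigma> :: real and sstar :: "real \<Rightarrow> real"
  assumes "\<sigma> > 0"
    and "\<And>k. k > 0 \<Longrightarrow> is_arg_min (J \<sigma> k) (\<lambda>s. s > 0) (sstar k)"
  shows "(\<lambda>k. sstar k - \<sigma>) \<in> O[at_top](\<lambda>k. 1 / k\<^sup>2)
    \<and> weak_conv_along (\<lambda>k. centered_gaussian (sstar k)) (centered_gaussian \<sigma>) at_top
    \<and> ((\<lambda>k. W2_squared (centered_gaussian (sstar k)) (centered_gaussian \<sigma>)) \<longlongrightarrow> 0) at_top
    \<and> (\<lambda>k. sstar k - k\<^sup>2 * \<sigma>) \<in> O[at_right 0](\<lambda>k. k ^ 4)
    \<and> (sstar \<longlongrightarrow> 0) (at_right 0)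
    \<and> (\<lambda>k. J \<sigma> k (sstar k) - k\<^sup>2 * \<sigma>\<^sup>2) \<in> O[at_right 0](\<lambda>k. k ^ 4)
    \<and> ((\<lambda>k. J \<sigma> k (sstar k)) \<longlongrightarrow> 0) (at_right 0)
    \<and> weak_conv_along (\<lambda>k. centered_gaussian (sstar k)) (return borel 0) (at_right 0)
    \<and> ((\<lambda>k. W2_squared (centered_gaussian (sstar k)) (return borel 0)) \<longlongrightarrow> 0) (at_right 0)"
proof -
  note \<sigma> = assms(1)
  define A where "A = \<sigma> * (1 + \<sigma>\<^sup>2)\<^sup>2"
  have pos: "sstar k > 0" if "k > 0" for k
    using assms(2)[OF that] by (simp add: is_arg_min_def)
  have critical: "sstar k = k\<^sup>2 * (\<sigma> - sstar k) * (1 + (sstar k)\<^sup>2)\<^sup>2" if "k > 0" for k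
    using arg_min_J_critical[OF assms(2)[OF that]] .
  \<comment> \<open>The constants depend on \<open>\<sigma>\<close> only, so they serve as the big-O
    constants in both regimes.\<close>
  note bounds = critical_far[OF pos _ critical] critical_expansion[OF pos _ critical]
    critical_value[OF pos _ critical, folded A_def]
  have top: "eventually (\<lambda>k::real. k > 0) at_top" by (rule eventually_gt_at_top)
  have zero: "eventually (\<lambda>k::real. k > 0) (at_right 0)"
    by (simp add: eventually_at_right_less)
  have pos_top: "eventually (\<lambda>k. sstar k > 0) at_top"
    using top by eventually_elim (rule pos)
  have pos_zero: "eventually (\<lambda>k. sstar k > 0) (at_right 0)"
    using zero by eventually_elim (rule pos)

  have O_top: "(\<lambda>k. sstar k - \<sigma>) \<in> O[at_top](\<lambda>k. 1 / k\<^sup>2)"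
  proof (rule bigoI[where c=\<sigma>])
    show "eventually (\<lambda>k. norm (sstar k - \<sigma>) \<le> \<sigma> * norm (1 / k\<^sup>2)) at_top"
      using top by eventually_elim (use bounds(1) in auto)
  qed
  have O_zero: "(\<lambda>k. sstar k - k\<^sup>2 * \<sigma>) \<in> O[at_right 0](\<lambda>k. k ^ 4)"
  proof (rule bigoI[where c="\<sigma> * (1 + \<sigma>\<^sup>2) ^ 4"])
    show "eventually (\<lambda>k. norm (sstar k - k\<^sup>2 * \<sigma>) \<le> \<sigma> * (1 + \<sigma>\<^sup>2) ^ 4 * norm (k ^ 4)) (at_right 0)"
      using zero by eventually_elim (use bounds(2) in auto)
  qed
  have O_J: "(\<lambda>k. J \<sigma> k (sstar k) - k\<^sup>2 * \<sigma>\<^sup>2) \<in> O[at_right 0](\<lambda>k. k ^ 4)"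
  proof (rule bigoI[where c="2 * \<sigma> * A + A\<^sup>2"])
    show "eventually (\<lambda>k. norm (J \<sigma> k (sstar k) - k\<^sup>2 * \<sigma>\<^sup>2)
        \<le> (2 * \<sigma> * A + A\<^sup>2) * norm (k ^ 4)) (at_right 0)"
      using zero by eventually_elim (use bounds(3) in auto)
  qed

  have "((\<lambda>k::real. 1 / k\<^sup>2) \<longlongrightarrow> 0) at_top"
    by (intro tendsto_divide_0[OF tendsto_const] filterlim_at_top_imp_at_infinity
        filterlim_pow_at_top filterlim_ident) simp
  from bigo_tendsto_zero[OF O_top this] have lim_top: "(sstar \<longlongrightarrow> \<sigma>) at_top"
    by (simp add: LIM_zero_cancel)
  have pow_zero: "((\<lambda>k::real. k ^ n * c) \<longlongrightarrow> 0) (at_right 0)" if "n > 0" for n c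
    using that by (auto intro!: tendsto_eq_intros simp: power_0_left)
  have pow4: "((\<lambda>k::real. k ^ 4) \<longlongrightarrow> 0) (at_right 0)"
    using pow_zero[of 4 1] by simp
  have lim_zero: "(sstar \<longlongrightarrow> 0) (at_right 0)"
    \<comment> \<open>Adding back the leading term \<open>k^2 * \<sigma>\<close>, which itself tends
      to 0.\<close>
    using tendsto_add[OF bigo_tendsto_zero[OF O_zero pow4] pow_zero[of 2 \<sigma>]] by simp
  have lim_J: "((\<lambda>k. J \<sigma> k (sstar k)) \<longlongrightarrow> 0) (at_right 0)"
    using tendsto_add[OF bigo_tendsto_zero[OF O_J pow4] pow_zero[of 2 "\<sigma>\<^sup>2"]] by simp

  \<comment> \<open>With \<open>\<delta>\<close> at 0 written as the image under scaling by 0, both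
    regimes become instances of the same two lemmas, with \<open>t = \<sigma>\<close> and
    \<open>t = 0\<close>.\<close>
  have zero_law: "distr std_normal_distribution borel (\<lambda>z. 0 * z) = return borel 0"
    using prob_space.distr_const_zero[OF prob_space_normal_density[of 1 0]] by simp
  show ?thesis
    unfolding zero_law[symmetric] centered_gaussian_eq_distr[OF \<sigma>]
    by (intro conjI O_top O_zero O_J lim_zero lim_J
      weak_conv_along_centered_gaussian tendsto_W2_squared_centered_gaussian
      lim_top pos_top pos_zero)
qed

end
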